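(* For every propositional formula $F$ built from prime (atomic) formulas using $\wedge$, $\vee$ and $\to$, there is a formula $e \in \mathcal{D}\cup\mathcal{C}$ such that $F \cong e$, where the classes $\mathcal{D}$, $\mathcal{C}$, $\mathcal{B}$ are defined simultaneously by \begin{align*} \mathcal{D}\ni d &::= c_1 \vee \cdots \vee c_n \quad (n\ge 2,\ c_i\in\mathcal{C}),\\ \mathcal{C}\ni c &::= (c_1\to b_1)\wedge\cdots\wedge(c_n\to b_n) \quad (n\ge 0,\ c_i\in\mathcal{C},\ b_i\in\mathcal{B}),\\ \mathcal{B}\ni b &::= p ~|~ d \quad (p \text{ a prime formula},\ d\in\mathcal{D}). \end{align*} In exponential-polynomial notation (writing $F\wedge G$ as $FG$, $F\vee G$ as $F+G$, $F\to G$ as $G^F$): $d=\sum_{i=1}^{n\ge2} c_i$, $c=\prod_{i=1}^{n\ge 0} b_i^{c_i}$, $b ::= p ~|~ d$.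
   Context: Formulas are those of intuitionistic (minimal) propositional logic. The nullary conjunction ($n=0$ in $\mathcal{C}$) is the formula $\top$ (the unit $1$); $\top$ is not a prime formula. Two formulas $F,G$ are isomorphic, $F\cong G$, if there are proofs (terms of the simply typed $\lambda$-calculus with product, sum and unit types, i.e. natural deduction proofs) $\phi$ of $F\to G$ and $\psi$ of $G\to F$ such that $\lambda a.\psi(\phi\, a) =_{\beta\eta} \lambda a.a$ and $\lambda c.\phi(\psi\, c)=_{\beta\eta}\lambda c.c$, where $=_{\beta\eta}$ is the standard $\beta\eta$-equality of this calculus. *)

theory Defs
  imports Main
begin

datatype 'p fm =
    Prime 'p
  | Top
  | And "'p fm" "'p fm"
  | Or "'p fm" "'p fm"
  | Imp "'p fm" "'p fm"

primrec top_free :: "'p fm \<Rightarrow> bool" where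
  "top_free (Prime p) \<longleftrightarrow> True"
| "top_free Top \<longleftrightarrow> False"
| "top_free (And A B) \<longleftrightarrow> top_free A \<and> top_free B"
| "top_free (Or A B) \<longleftrightarrow> top_free A \<and> top_free B"
| "top_free (Imp A B) \<longleftrightarrow> top_free A \<and> top_free B"

text \<open>
  Finite conjunctions and disjunctions associate to the right, and a unary one is its only
  member. The disjunction of the empty list is left unspecified: there is no falsum.
\<close>

fun big_and :: "'p fm list \<Rightarrow> 'p fm" where
  "big_and [] = Top"
| "big_and [A] = A"
| "big_and (A # B # As) = And A (big_and (B # As))"

fun big_or :: "'p fm list \<Rightarrow> 'p fm" where
  "big_or [A] = A"
| "big_or (A # B # As) = Or A (big_or (B # As))"

inductive_set D_forms :: "'p fm set" and C_forms :: "'p fm set" and B_forms :: "'p fm set"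
where
  D_disj: "\<lbrakk>length cs \<ge> 2; \<forall>c \<in> set cs. c \<in> C_forms\<rbrakk> \<Longrightarrow> big_or cs \<in> D_forms"
| C_conj: "\<forall>c b. (c, b) \<in> set cbs \<longrightarrow> c \<in> C_forms \<and> b \<in> B_forms \<Longrightarrow>
    big_and (map (\<lambda>(c, b). Imp c b) cbs) \<in> C_forms"
| B_prime: "Prime p \<in> B_forms"
| B_disj: "d \<in> D_forms \<Longrightarrow> d \<in> B_forms"

text \<open>
  Terms use de Bruijn indices. The annotation of \<open>Lam\<close> is the type of the bound variable;
  \<open>InL B t\<close> injects \<open>t : A\<close> into \<open>Or A B\<close>, and \<open>InR A t\<close> injects \<open>t : B\<close> into \<open>Or A B\<close>.
  With these annotations a term has at most one type in a given context.
  Each branch of \<open>Case\<close> binds one variable.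
\<close>

datatype 'p tm =
    Var nat
  | Star
  | Lam "'p fm" "'p tm"
  | App "'p tm" "'p tm"
  | MkPair "'p tm" "'p tm"
  | Fst "'p tm"
  | Snd "'p tm"
  | InL "'p fm" "'p tm"
  | InR "'p fm" "'p tm"
  | Case "'p tm" "'p tm" "'p tm"

definition up_ren :: "(nat \<Rightarrow> nat) \<Rightarrow> nat \<Rightarrow> nat" where
  "up_ren r = case_nat 0 (\<lambda>i. Suc (r i))"

primrec rename :: "(nat \<Rightarrow> nat) \<Rightarrow> 'p tm \<Rightarrow> 'p tm" where
  "rename r (Var i) = Var (r i)"
| "rename r Star = Star"
| "rename r (Lam A t) = Lam A (rename (up_ren r) t)"
| "rename r (App t u) = App (rename r t) (rename r u)"
| "rename r (MkPair t u) = MkPair (rename r t) (rename r u)"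
| "rename r (Fst t) = Fst (rename r t)"
| "rename r (Snd t) = Snd (rename r t)"
| "rename r (InL B t) = InL B (rename r t)"
| "rename r (InR A t) = InR A (rename r t)"
| "rename r (Case t u v) = Case (rename r t) (rename (up_ren r) u) (rename (up_ren r) v)"

definition up_sub :: "(nat \<Rightarrow> 'p tm) \<Rightarrow> nat \<Rightarrow> 'p tm" where
  "up_sub s = case_nat (Var 0) (\<lambda>i. rename Suc (s i))"

primrec subst :: "(nat \<Rightarrow> 'p tm) \<Rightarrow> 'p tm \<Rightarrow> 'p tm" where
  "subst s (Var i) = s i"
| "subst s Star = Star"
| "subst s (Lam A t) = Lam A (subst (up_sub s) t)"
| "subst s (App t u) = App (subst s t) (subst s u)"
| "subst s (MkPair t u) = MkPair (subst s t) (subst s u)"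
| "subst s (Fst t) = Fst (subst s t)"
| "subst s (Snd t) = Snd (subst s t)"
| "subst s (InL B t) = InL B (subst s t)"
| "subst s (InR A t) = InR A (subst s t)"
| "subst s (Case t u v) = Case (subst s t) (subst (up_sub s) u) (subst (up_sub s) v)"

text \<open>\<open>inst u t\<close> replaces variable 0 of \<open>t\<close> by \<open>u\<close> and lowers the other variables by one.\<close>

definition inst :: "'p tm \<Rightarrow> 'p tm \<Rightarrow> 'p tm" where
  "inst u t = subst (case_nat u Var) t"

inductive typing :: "'p fm list \<Rightarrow> 'p tm \<Rightarrow> 'p fm \<Rightarrow> bool"
  ("(_ \<turnstile>/ _ \<^bold>:/ _)" [51, 51, 51] 50)
where
  ty_Var: "i < length \<Gamma> \<Longrightarrow> \<Gamma> \<turnstile> Var i \<^bold>: \<Gamma> ! i"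
| ty_Star: "\<Gamma> \<turnstile> Star \<^bold>: Top"
| ty_Lam: "A # \<Gamma> \<turnstile> t \<^bold>: B \<Longrightarrow> \<Gamma> \<turnstile> Lam A t \<^bold>: Imp A B"
| ty_App: "\<lbrakk>\<Gamma> \<turnstile> t \<^bold>: Imp A B; \<Gamma> \<turnstile> u \<^bold>: A\<rbrakk> \<Longrightarrow> \<Gamma> \<turnstile> App t u \<^bold>: B"
| ty_MkPair: "\<lbrakk>\<Gamma> \<turnstile> t \<^bold>: A; \<Gamma> \<turnstile> u \<^bold>: B\<rbrakk> \<Longrightarrow> \<Gamma> \<turnstile> MkPair t u \<^bold>: And A B"
| ty_Fst: "\<Gamma> \<turnstile> t \<^bold>: And A B \<Longrightarrow> \<Gamma> \<turnstile> Fst t \<^bold>: A"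
| ty_Snd: "\<Gamma> \<turnstile> t \<^bold>: And A B \<Longrightarrow> \<Gamma> \<turnstile> Snd t \<^bold>: B"
| ty_InL: "\<Gamma> \<turnstile> t \<^bold>: A \<Longrightarrow> \<Gamma> \<turnstile> InL B t \<^bold>: Or A B"
| ty_InR: "\<Gamma> \<turnstile> t \<^bold>: B \<Longrightarrow> \<Gamma> \<turnstile> InR A t \<^bold>: Or A B"
| ty_Case: "\<lbrakk>\<Gamma> \<turnstile> t \<^bold>: Or A B; A # \<Gamma> \<turnstile> u \<^bold>: C; B # \<Gamma> \<turnstile> v \<^bold>: C\<rbrakk> \<Longrightarrow> \<Gamma> \<turnstile> Case t u v \<^bold>: C"

text \<open>
  The rule \<open>eta_Or\<close> is the extensionality (uniqueness) rule for sums; it subsumes the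
  commuting conversions. The term \<open>t\<close> there lives in the context \<open>Or A B # \<Gamma>\<close>, and its
  variable 0 is replaced by an injection of the variable bound by the branch, the others
  being unchanged.
\<close>

inductive beta_eta :: "'p fm list \<Rightarrow> 'p tm \<Rightarrow> 'p tm \<Rightarrow> 'p fm \<Rightarrow> bool"
  ("(_ \<turnstile>/ _ \<approx>/ _ \<^bold>:/ _)" [51, 51, 51, 51] 50)
where
  eq_refl: "\<Gamma> \<turnstile> t \<^bold>: A \<Longrightarrow> \<Gamma> \<turnstile> t \<approx> t \<^bold>: A"
| eq_sym: "\<Gamma> \<turnstile> t \<approx> u \<^bold>: A \<Longrightarrow> \<Gamma> \<turnstile> u \<approx> t \<^bold>: A"
| eq_trans: "\<lbrakk>\<Gamma> \<turnstile> t \<approx> u \<^bold>: A; \<Gamma> \<turnstile> u \<approx> v \<^bold>: A\<rbrakk> \<Longrightarrow> \<Gamma> \<turnstile> t \<approx> v \<^bold>: A"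
| cong_Lam: "A # \<Gamma> \<turnstile> t \<approx> t' \<^bold>: B \<Longrightarrow> \<Gamma> \<turnstile> Lam A t \<approx> Lam A t' \<^bold>: Imp A B"
| cong_App: "\<lbrakk>\<Gamma> \<turnstile> t \<approx> t' \<^bold>: Imp A B; \<Gamma> \<turnstile> u \<approx> u' \<^bold>: A\<rbrakk> \<Longrightarrow> \<Gamma> \<turnstile> App t u \<approx> App t' u' \<^bold>: B"
| cong_MkPair: "\<lbrakk>\<Gamma> \<turnstile> t \<approx> t' \<^bold>: A; \<Gamma> \<turnstile> u \<approx> u' \<^bold>: B\<rbrakk> \<Longrightarrow>
    \<Gamma> \<turnstile> MkPair t u \<approx> MkPair t' u' \<^bold>: And A B"
| cong_Fst: "\<Gamma> \<turnstile> t \<approx> t' \<^bold>: And A B \<Longrightarrow> \<Gamma> \<turnstile> Fst t \<approx> Fst t' \<^bold>: A"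
| cong_Snd: "\<Gamma> \<turnstile> t \<approx> t' \<^bold>: And A B \<Longrightarrow> \<Gamma> \<turnstile> Snd t \<approx> Snd t' \<^bold>: B"
| cong_InL: "\<Gamma> \<turnstile> t \<approx> t' \<^bold>: A \<Longrightarrow> \<Gamma> \<turnstile> InL B t \<approx> InL B t' \<^bold>: Or A B"
| cong_InR: "\<Gamma> \<turnstile> t \<approx> t' \<^bold>: B \<Longrightarrow> \<Gamma> \<turnstile> InR A t \<approx> InR A t' \<^bold>: Or A B"
| cong_Case: "\<lbrakk>\<Gamma> \<turnstile> t \<approx> t' \<^bold>: Or A B; A # \<Gamma> \<turnstile> u \<approx> u' \<^bold>: C; B # \<Gamma> \<turnstile> v \<approx> v' \<^bold>: C\<rbrakk> \<Longrightarrow>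
    \<Gamma> \<turnstile> Case t u v \<approx> Case t' u' v' \<^bold>: C"
| beta_Imp: "\<lbrakk>A # \<Gamma> \<turnstile> t \<^bold>: B; \<Gamma> \<turnstile> u \<^bold>: A\<rbrakk> \<Longrightarrow> \<Gamma> \<turnstile> App (Lam A t) u \<approx> inst u t \<^bold>: B"
| beta_Fst: "\<lbrakk>\<Gamma> \<turnstile> t \<^bold>: A; \<Gamma> \<turnstile> u \<^bold>: B\<rbrakk> \<Longrightarrow> \<Gamma> \<turnstile> Fst (MkPair t u) \<approx> t \<^bold>: A"
| beta_Snd: "\<lbrakk>\<Gamma> \<turnstile> t \<^bold>: A; \<Gamma> \<turnstile> u \<^bold>: B\<rbrakk> \<Longrightarrow> \<Gamma> \<turnstile> Snd (MkPair t u) \<approx> u \<^bold>: B"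
| beta_InL: "\<lbrakk>\<Gamma> \<turnstile> t \<^bold>: A; A # \<Gamma> \<turnstile> u \<^bold>: C; B # \<Gamma> \<turnstile> v \<^bold>: C\<rbrakk> \<Longrightarrow>
    \<Gamma> \<turnstile> Case (InL B t) u v \<approx> inst t u \<^bold>: C"
| beta_InR: "\<lbrakk>\<Gamma> \<turnstile> t \<^bold>: B; A # \<Gamma> \<turnstile> u \<^bold>: C; B # \<Gamma> \<turnstile> v \<^bold>: C\<rbrakk> \<Longrightarrow>
    \<Gamma> \<turnstile> Case (InR A t) u v \<approx> inst t v \<^bold>: C"
| eta_Imp: "\<Gamma> \<turnstile> t \<^bold>: Imp A B \<Longrightarrow> \<Gamma> \<turnstile> Lam A (App (rename Suc t) (Var 0)) \<approx> t \<^bold>: Imp A B"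
| eta_And: "\<Gamma> \<turnstile> t \<^bold>: And A B \<Longrightarrow> \<Gamma> \<turnstile> MkPair (Fst t) (Snd t) \<approx> t \<^bold>: And A B"
| eta_Top: "\<Gamma> \<turnstile> t \<^bold>: Top \<Longrightarrow> \<Gamma> \<turnstile> t \<approx> Star \<^bold>: Top"
| eta_Or: "\<lbrakk>\<Gamma> \<turnstile> u \<^bold>: Or A B; Or A B # \<Gamma> \<turnstile> t \<^bold>: C\<rbrakk> \<Longrightarrow>
    \<Gamma> \<turnstile> inst u t \<approx>
      Case u (subst (case_nat (InL B (Var 0)) (\<lambda>i. Var (Suc i))) t)
             (subst (case_nat (InR A (Var 0)) (\<lambda>i. Var (Suc i))) t) \<^bold>: C"

definition iso :: "'p fm \<Rightarrow> 'p fm \<Rightarrow> bool" (infix "\<cong>" 50) where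
  "F \<cong> G \<longleftrightarrow> (\<exists>\<phi> \<psi>.
     [] \<turnstile> \<phi> \<^bold>: Imp F G \<and> [] \<turnstile> \<psi> \<^bold>: Imp G F \<and>
     [] \<turnstile> Lam F (App (rename Suc \<psi>) (App (rename Suc \<phi>) (Var 0))) \<approx> Lam F (Var 0) \<^bold>: Imp F F \<and>
     [] \<turnstile> Lam G (App (rename Suc \<phi>) (App (rename Suc \<psi>) (Var 0))) \<approx> Lam G (Var 0) \<^bold>: Imp G G)"

end

theory Submission
  imports Defs
begin

text \<open>
  Every formula is a nonempty sum of \<open>\<C>\<close>-formulas, by induction on the formula. A prime
  \<open>p\<close> is the one-factor product \<open>p\<^sup>1\<close>, sums are concatenated, products are distributed, and a
  power is expanded by \<open>a\<^bsup>b+c\<^esup> = a\<^sup>b a\<^sup>c\<close>, \<open>(a b)\<^sup>c = a\<^sup>c b\<^sup>c\<close>, \<open>(a\<^sup>b)\<^sup>c = a\<^bsup>b c\<^esup>\<close>,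
  \<open>1\<^sup>c = 1\<close> until each base is a prime or a sum of at least two terms. Each of these
  high-school identities is an isomorphism witnessed by closed terms, which makes the witnesses inert under renaming and substitution.
\<close>

section \<open>Typing\<close>

\<comment> \<open>Typing is syntax-directed, so the inverted rules work as rewrite rules by which
  the simplifier settles the type of a concrete term.\<close>
inductive_simps typing_simps:
  "\<Gamma> \<turnstile> Var i \<^bold>: T"
  "\<Gamma> \<turnstile> Star \<^bold>: T"
  "\<Gamma> \<turnstile> Lam A t \<^bold>: T"
  "\<Gamma> \<turnstile> App t u \<^bold>: T"
  "\<Gamma> \<turnstile> MkPair t u \<^bold>: T"
  "\<Gamma> \<turnstile> Fst t \<^bold>: T"
  "\<Gamma> \<turnstile> Snd t \<^bold>: T"
  "\<Gamma> \<turnstile> InL B t \<^bold>: T"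
  "\<Gamma> \<turnstile> InR B t \<^bold>: T"
  "\<Gamma> \<turnstile> Case t u v \<^bold>: T"

lemma up_ren_simps [simp]: "up_ren r 0 = 0" "up_ren r (Suc i) = Suc (r i)"
  by (simp_all add: up_ren_def)

lemma up_sub_simps [simp]: "up_sub s 0 = Var 0" "up_sub s (Suc i) = rename Suc (s i)"
  by (simp_all add: up_sub_def)

text \<open>Weakening alone would not pass under a binder. A renaming that respects the types of the
  indices in scope does, since \<open>up_ren\<close> respects them again.\<close>

lemma typing_rename:
  assumes "\<Gamma> \<turnstile> t \<^bold>: A" "\<And>i. i < length \<Gamma> \<Longrightarrow> r i < length \<Delta> \<and> \<Delta> ! r i = \<Gamma> ! i"
  shows "\<Delta> \<turnstile> rename r t \<^bold>: A"
  using assms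
proof (induction arbitrary: \<Delta> r)
  case (ty_Lam A \<Gamma> t B)
  have "A # \<Delta> \<turnstile> rename (up_ren r) t \<^bold>: B"
    by (rule ty_Lam.IH) (use ty_Lam.prems in \<open>auto simp: less_Suc_eq_0_disj\<close>)
  then show ?case by (simp add: typing_simps)
next
  case (ty_Case \<Gamma> t A B u C v)
  have "A # \<Delta> \<turnstile> rename (up_ren r) u \<^bold>: C" "B # \<Delta> \<turnstile> rename (up_ren r) v \<^bold>: C"
    by (rule ty_Case.IH; use ty_Case.prems in \<open>auto simp: less_Suc_eq_0_disj\<close>)+
  then show ?case using ty_Case.IH(1)[OF ty_Case.prems] by (auto intro: typing.ty_Case)
next
  case (ty_Var i \<Gamma>)
  then show ?case by (simp add: typing_simps)
next
  case (ty_App \<Gamma> t A B u)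
  show ?case using ty_App.IH[OF ty_App.prems] by (auto intro: typing.ty_App)
next
  case (ty_Fst \<Gamma> t A B)
  show ?case using ty_Fst.IH[OF ty_Fst.prems] by (auto intro: typing.ty_Fst)
next
  case (ty_Snd \<Gamma> t A B)
  show ?case using ty_Snd.IH[OF ty_Snd.prems] by (auto intro: typing.ty_Snd)
qed (simp_all add: typing.intros)

lemma typing_weaken: "\<Gamma> \<turnstile> t \<^bold>: A \<Longrightarrow> B # \<Gamma> \<turnstile> rename Suc t \<^bold>: A"
  by (erule typing_rename) simp

lemma typing_up_sub:
  assumes "\<And>i. i < length \<Gamma> \<Longrightarrow> \<Delta> \<turnstile> s i \<^bold>: \<Gamma> ! i" "i < length (A # \<Gamma>)"
  shows "A # \<Delta> \<turnstile> up_sub s i \<^bold>: (A # \<Gamma>) ! i"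
proof (cases i)
  case 0
  then show ?thesis by (simp add: typing_simps)
next
  case (Suc j)
  then have "\<Delta> \<turnstile> s j \<^bold>: \<Gamma> ! j" using assms by simp
  from typing_weaken[OF this] Suc show ?thesis by simp
qed

lemma typing_subst:
  assumes "\<Gamma> \<turnstile> t \<^bold>: A" "\<And>i. i < length \<Gamma> \<Longrightarrow> \<Delta> \<turnstile> s i \<^bold>: \<Gamma> ! i"
  shows "\<Delta> \<turnstile> subst s t \<^bold>: A"
  using assms
proof (induction arbitrary: \<Delta> s)
  case (ty_Lam A \<Gamma> t B)
  have "A # \<Delta> \<turnstile> subst (up_sub s) t \<^bold>: B"
    by (rule ty_Lam.IH; rule typing_up_sub; (erule ty_Lam.prems | assumption))
  then show ?case by (simp add: typing_simps)
next
  case (ty_Case \<Gamma> t A B u C v)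
  have "A # \<Delta> \<turnstile> subst (up_sub s) u \<^bold>: C" "B # \<Delta> \<turnstile> subst (up_sub s) v \<^bold>: C"
    by (rule ty_Case.IH; rule typing_up_sub; (erule ty_Case.prems | assumption))+
  then show ?case using ty_Case.IH(1)[OF ty_Case.prems] by (auto intro: typing.ty_Case)
next
  case (ty_Var i \<Gamma>)
  then show ?case by (simp add: typing_simps)
next
  case (ty_App \<Gamma> t A B u)
  show ?case using ty_App.IH[OF ty_App.prems] by (auto intro: typing.ty_App)
next
  case (ty_Fst \<Gamma> t A B)
  show ?case using ty_Fst.IH[OF ty_Fst.prems] by (auto intro: typing.ty_Fst)
next
  case (ty_Snd \<Gamma> t A B)
  show ?case using ty_Snd.IH[OF ty_Snd.prems] by (auto intro: typing.ty_Snd)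
qed (simp_all add: typing.intros)

lemma typing_inst: "A # \<Gamma> \<turnstile> t \<^bold>: B \<Longrightarrow> \<Gamma> \<turnstile> u \<^bold>: A \<Longrightarrow> \<Gamma> \<turnstile> inst u t \<^bold>: B"
  unfolding inst_def
  by (rule typing_subst) (auto simp: less_Suc_eq_0_disj typing_simps)

text \<open>The annotations on \<open>Lam\<close>, \<open>InL\<close> and \<open>InR\<close> fix
  what the subterms leave open. The reducer relies on this when it contracts a surjective
  pair.\<close>

lemma typing_unique: "\<Gamma> \<turnstile> t \<^bold>: A \<Longrightarrow> \<Gamma> \<turnstile> t \<^bold>: T \<Longrightarrow> A = T"
proof (induction arbitrary: T rule: typing.induct)
  case (ty_Case \<Gamma> t A B u C v)
  \<comment> \<open>The scrutinee comes first: the induction hypothesis for the branch concerns the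
    context headed by \<open>A\<close>, so \<open>A' = A\<close> must be known before it
    applies.\<close>
  from ty_Case.prems obtain A' B' where "\<Gamma> \<turnstile> t \<^bold>: Or A' B'" and u: "A' # \<Gamma> \<turnstile> u \<^bold>: T"
    unfolding typing_simps by blast
  with ty_Case.IH(1) have "A' = A" by blast
  with u show ?case by (blast intro: ty_Case.IH(2))
next
  case (ty_Lam A \<Gamma> t B)
  from ty_Lam.prems show ?case by (auto simp: typing_simps dest: ty_Lam.IH)
next
  case (ty_App \<Gamma> t A B u)
  from ty_App.prems show ?case by (auto simp: typing_simps dest: ty_App.IH)
next
  case (ty_MkPair \<Gamma> t A u B)
  from ty_MkPair.prems show ?case by (auto simp: typing_simps dest: ty_MkPair.IH)
next
  case (ty_Fst \<Gamma> t A B)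
  from ty_Fst.prems show ?case by (auto simp: typing_simps dest: ty_Fst.IH)
next
  case (ty_Snd \<Gamma> t A B)
  from ty_Snd.prems show ?case by (auto simp: typing_simps dest: ty_Snd.IH)
next
  case (ty_InL \<Gamma> t A B)
  from ty_InL.prems show ?case by (auto simp: typing_simps dest: ty_InL.IH)
next
  case (ty_InR \<Gamma> t B A)
  from ty_InR.prems show ?case by (auto simp: typing_simps dest: ty_InR.IH)
qed (simp_all add: typing_simps)

section \<open>A verified reducer\<close>

text \<open>Equations between concrete terms are settled by computing a few rounds of parallel
  reduction on both sides. Surjective pairing is contracted too; the other extensionality
  rules are applied by hand.\<close>

primrec dev :: "'p tm \<Rightarrow> 'p tm" where
  "dev (Var i) = Var i"
| "dev Star = Star"
| "dev (Lam A t) = Lam A (dev t)"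
| "dev (App t u) = (case dev t of Lam A b \<Rightarrow> inst (dev u) b | t' \<Rightarrow> App t' (dev u))"
| "dev (MkPair t u) =
    (case dev t of
       Fst a \<Rightarrow> if dev u = Snd a then a else MkPair (dev t) (dev u)
     | t' \<Rightarrow> MkPair t' (dev u))"
| "dev (Fst t) = (case dev t of MkPair a b \<Rightarrow> a | t' \<Rightarrow> Fst t')"
| "dev (Snd t) = (case dev t of MkPair a b \<Rightarrow> b | t' \<Rightarrow> Snd t')"
| "dev (InL B t) = InL B (dev t)"
| "dev (InR A t) = InR A (dev t)"
| "dev (Case t u v) =
    (case dev t of
       InL B a \<Rightarrow> inst a (dev u)
     | InR A b \<Rightarrow> inst b (dev v)
     | t' \<Rightarrow> Case t' (dev u) (dev v))"

text \<open>Typing and equality are proved together, because the beta and eta rules have typing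
  premises that must be available for the reduced subterms. Where a redex can arise,
  \<open>c\<close> reduces the subterms by congruence, and then at most the root is
  contracted.\<close>

lemma dev_sound:
  assumes "\<Gamma> \<turnstile> t \<^bold>: A"
  shows "\<Gamma> \<turnstile> dev t \<^bold>: A \<and> \<Gamma> \<turnstile> t \<approx> dev t \<^bold>: A"
  using assms
proof induction
  case (ty_App \<Gamma> t A B u)
  have c: "\<Gamma> \<turnstile> App t u \<approx> App (dev t) (dev u) \<^bold>: B"
    using ty_App.IH by (blast intro: cong_App)
  show ?case
  proof (cases "dev t")
    case (Lam A' b)
    then have r: "\<Gamma> \<turnstile> App (dev t) (dev u) \<approx> inst (dev u) b \<^bold>: B" "\<Gamma> \<turnstile> inst (dev u) b \<^bold>: B"
      using ty_App.IH by (auto simp: typing_simps intro: beta_Imp typing_inst)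
    show ?thesis using eq_trans[OF c r(1)] r(2) Lam by simp
  qed (use c ty_App.IH in \<open>auto intro: typing.ty_App\<close>)
next
  case (ty_MkPair \<Gamma> t A u B)
  have c: "\<Gamma> \<turnstile> MkPair t u \<approx> MkPair (dev t) (dev u) \<^bold>: And A B"
    using ty_MkPair.IH by (blast intro: cong_MkPair)
  have p: "\<Gamma> \<turnstile> MkPair (dev t) (dev u) \<^bold>: And A B"
    using ty_MkPair.IH by (blast intro: typing.ty_MkPair)
  \<comment> \<open>The types of \<open>Fst a\<close> and \<open>Snd a\<close> each determine only
    one half of the type of \<open>a\<close>. Uniqueness of typing makes the halves fit, and
    \<open>eta_And\<close> applies.\<close>
  have e: "\<Gamma> \<turnstile> a \<^bold>: And A B \<and> \<Gamma> \<turnstile> MkPair (dev t) (dev u) \<approx> a \<^bold>: And A B"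
    if eq: "dev t = Fst a" "dev u = Snd a" for a
  proof -
    obtain A' B' where ty: "\<Gamma> \<turnstile> a \<^bold>: And A B'" "\<Gamma> \<turnstile> a \<^bold>: And A' B"
      using ty_MkPair.IH unfolding eq typing_simps by blast
    then have "B' = B" by (auto dest: typing_unique)
    with ty eq show ?thesis by (auto intro: eta_And)
  qed
  show ?case
  proof (cases "\<exists>a. dev t = Fst a \<and> dev u = Snd a")
    case True
    then obtain a where a: "dev t = Fst a" "dev u = Snd a" by blast
    show ?thesis using e[OF a] eq_trans[OF c, of a] a by simp
  next
    case False
    then have "dev (MkPair t u) = MkPair (dev t) (dev u)" by (auto split: tm.splits)
    with c p show ?thesis by simp
  qed
next
  case (ty_Fst \<Gamma> t A B)
  have c: "\<Gamma> \<turnstile> Fst t \<approx> Fst (dev t) \<^bold>: A"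
    using ty_Fst.IH by (blast intro: cong_Fst)
  show ?case
  proof (cases "dev t")
    case (MkPair a b)
    then have r: "\<Gamma> \<turnstile> Fst (dev t) \<approx> a \<^bold>: A" "\<Gamma> \<turnstile> a \<^bold>: A"
      using ty_Fst.IH by (auto simp: typing_simps intro: beta_Fst)
    show ?thesis using eq_trans[OF c r(1)] r(2) MkPair by simp
  qed (use c ty_Fst.IH in \<open>auto intro: typing.ty_Fst\<close>)
next
  case (ty_Snd \<Gamma> t A B)
  have c: "\<Gamma> \<turnstile> Snd t \<approx> Snd (dev t) \<^bold>: B"
    using ty_Snd.IH by (blast intro: cong_Snd)
  show ?case
  proof (cases "dev t")
    case (MkPair a b)
    then have r: "\<Gamma> \<turnstile> Snd (dev t) \<approx> b \<^bold>: B" "\<Gamma> \<turnstile> b \<^bold>: B"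
      using ty_Snd.IH by (auto simp: typing_simps intro: beta_Snd)
    show ?thesis using eq_trans[OF c r(1)] r(2) MkPair by simp
  qed (use c ty_Snd.IH in \<open>auto intro: typing.ty_Snd\<close>)
next
  case (ty_Case \<Gamma> t A B u C v)
  have c: "\<Gamma> \<turnstile> Case t u v \<approx> Case (dev t) (dev u) (dev v) \<^bold>: C"
    using ty_Case.IH by (blast intro: cong_Case)
  show ?case
  proof (cases "dev t")
    case (InL B' a)
    then have r: "\<Gamma> \<turnstile> Case (dev t) (dev u) (dev v) \<approx> inst a (dev u) \<^bold>: C"
      "\<Gamma> \<turnstile> inst a (dev u) \<^bold>: C"
      using ty_Case.IH by (auto simp: typing_simps intro: beta_InL typing_inst)
    show ?thesis using eq_trans[OF c r(1)] r(2) InL by simp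
  next
    case (InR A' b)
    then have r: "\<Gamma> \<turnstile> Case (dev t) (dev u) (dev v) \<approx> inst b (dev v) \<^bold>: C"
      "\<Gamma> \<turnstile> inst b (dev v) \<^bold>: C"
      using ty_Case.IH by (auto simp: typing_simps intro: beta_InR typing_inst)
    show ?thesis using eq_trans[OF c r(1)] r(2) InR by simp
  qed (use c ty_Case.IH in \<open>auto intro: typing.ty_Case\<close>)
qed (simp_all add: typing.intros eq_refl cong_Lam cong_InL cong_InR)

text \<open>Both terms equal their common iterate. The number of rounds is chosen by hand at each
  use, and the last premise is checked by evaluation.\<close>

lemma conv:
  assumes "\<Gamma> \<turnstile> t \<^bold>: A" "\<Gamma> \<turnstile> u \<^bold>: A" "(dev ^^ n) t = (dev ^^ n) u"
  shows "\<Gamma> \<turnstile> t \<approx> u \<^bold>: A"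
proof -
  have "\<Gamma> \<turnstile> (dev ^^ n) t \<^bold>: A \<and> \<Gamma> \<turnstile> t \<approx> (dev ^^ n) t \<^bold>: A" if "\<Gamma> \<turnstile> t \<^bold>: A" for t
  proof (induction n)
    case 0
    show ?case using that by (simp add: eq_refl)
  next
    case (Suc n)
    then show ?case using dev_sound[of \<Gamma> "(dev ^^ n) t" A] eq_trans by fastforce
  qed
  with assms show ?thesis by (metis eq_sym eq_trans)
qed

section \<open>Extensionality\<close>

lemma ext_Top: "\<Gamma> \<turnstile> t \<^bold>: Top \<Longrightarrow> \<Gamma> \<turnstile> u \<^bold>: Top \<Longrightarrow> \<Gamma> \<turnstile> t \<approx> u \<^bold>: Top"
  by (blast intro: eq_trans eq_sym eta_Top)

lemma ext_And:
  assumes "\<Gamma> \<turnstile> t \<^bold>: And A B" "\<Gamma> \<turnstile> u \<^bold>: And A B"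
    "\<Gamma> \<turnstile> Fst t \<approx> Fst u \<^bold>: A" "\<Gamma> \<turnstile> Snd t \<approx> Snd u \<^bold>: B"
  shows "\<Gamma> \<turnstile> t \<approx> u \<^bold>: And A B"
  by (rule eq_trans[OF eq_sym[OF eta_And[OF assms(1)]]
        eq_trans[OF cong_MkPair[OF assms(3,4)] eta_And[OF assms(2)]]])

lemma ext_Imp:
  assumes "\<Gamma> \<turnstile> f \<^bold>: Imp A B" "\<Gamma> \<turnstile> g \<^bold>: Imp A B"
    "A # \<Gamma> \<turnstile> App (rename Suc f) (Var 0) \<approx> App (rename Suc g) (Var 0) \<^bold>: B"
  shows "\<Gamma> \<turnstile> f \<approx> g \<^bold>: Imp A B"
  by (rule eq_trans[OF eq_sym[OF eta_Imp[OF assms(1)]]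
        eq_trans[OF cong_Lam[OF assms(3)] eta_Imp[OF assms(2)]]])

text \<open>Case analysis on a subterm \<open>u\<close> of sum type: \<open>eta_Or\<close> turns
  both sides into a \<open>Case\<close> on \<open>u\<close>, and the branches are compared. The
  sides \<open>l\<close> and \<open>r\<close> are tied to \<open>t\<close> and \<open>t'\<close> by
  equations so that \<open>inst\<close> is computed rather than unified.\<close>

lemma ext_Or:
  assumes "\<Gamma> \<turnstile> u \<^bold>: Or A B" "Or A B # \<Gamma> \<turnstile> t \<^bold>: C" "Or A B # \<Gamma> \<turnstile> t' \<^bold>: C"
    "A # \<Gamma> \<turnstile> subst (case_nat (InL B (Var 0)) (\<lambda>i. Var (Suc i))) t \<approx>
        subst (case_nat (InL B (Var 0)) (\<lambda>i. Var (Suc i))) t' \<^bold>: C"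
    "B # \<Gamma> \<turnstile> subst (case_nat (InR A (Var 0)) (\<lambda>i. Var (Suc i))) t \<approx>
        subst (case_nat (InR A (Var 0)) (\<lambda>i. Var (Suc i))) t' \<^bold>: C"
    "l = inst u t" "r = inst u t'"
  shows "\<Gamma> \<turnstile> l \<approx> r \<^bold>: C"
  unfolding assms(6,7)
  by (rule eq_trans[OF eta_Or[OF assms(1,2)]
        eq_trans[OF cong_Case[OF eq_refl[OF assms(1)] assms(4,5)] eq_sym[OF eta_Or[OF assms(1,3)]]]])

section \<open>Isomorphisms given by closed terms\<close>

text \<open>The typing clause is an equivalence over all contexts, so that it rewrites like
  \<open>typing_simps\<close> even when the term is opaque. Closedness is rendered as invariance
  under every renaming and substitution.\<close>

definition closed_arr :: "'p tm \<Rightarrow> 'p fm \<Rightarrow> 'p fm \<Rightarrow> bool" where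
  "closed_arr \<phi> F G \<longleftrightarrow>
     (\<forall>\<Gamma> T. \<Gamma> \<turnstile> \<phi> \<^bold>: T \<longleftrightarrow> T = Imp F G) \<and> (\<forall>r. rename r \<phi> = \<phi>) \<and> (\<forall>s. subst s \<phi> = \<phi>)"

text \<open>One half of an isomorphism. The other half has the same form with the roles exchanged,
  so each closure property needs a single proof.\<close>

definition retraction :: "'p tm \<Rightarrow> 'p tm \<Rightarrow> 'p fm \<Rightarrow> 'p fm \<Rightarrow> bool" where
  "retraction \<phi> \<psi> F G \<longleftrightarrow> closed_arr \<phi> F G \<and> closed_arr \<psi> G F \<and>
     (\<forall>\<Gamma>. F # \<Gamma> \<turnstile> App \<psi> (App \<phi> (Var 0)) \<approx> Var 0 \<^bold>: F)"

definition closed_iso :: "'p fm \<Rightarrow> 'p fm \<Rightarrow> bool" where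
  "closed_iso F G \<longleftrightarrow> (\<exists>\<phi> \<psi>. retraction \<phi> \<psi> F G \<and> retraction \<psi> \<phi> G F)"

lemma closed_isoI:
  assumes "closed_arr \<phi> F G" "closed_arr \<psi> G F"
    "\<And>\<Gamma>. F # \<Gamma> \<turnstile> App \<psi> (App \<phi> (Var 0)) \<approx> Var 0 \<^bold>: F"
    "\<And>\<Gamma>. G # \<Gamma> \<turnstile> App \<phi> (App \<psi> (Var 0)) \<approx> Var 0 \<^bold>: G"
  shows "closed_iso F G"
  using assms unfolding closed_iso_def retraction_def by blast

lemma closed_iso_imp_iso:
  assumes "closed_iso F G"
  shows "F \<cong> G"
proof -
  from assms obtain \<phi> \<psi> where *: "retraction \<phi> \<psi> F G" "retraction \<psi> \<phi> G F"
    unfolding closed_iso_def by blast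
  then have "rename Suc \<phi> = \<phi>" "rename Suc \<psi> = \<psi>" "[] \<turnstile> \<phi> \<^bold>: Imp F G" "[] \<turnstile> \<psi> \<^bold>: Imp G F"
    "[F] \<turnstile> App \<psi> (App \<phi> (Var 0)) \<approx> Var 0 \<^bold>: F" "[G] \<turnstile> App \<phi> (App \<psi> (Var 0)) \<approx> Var 0 \<^bold>: G"
    unfolding retraction_def closed_arr_def by blast+
  then show ?thesis unfolding iso_def
    by (intro exI[of _ \<phi>] exI[of _ \<psi>]) (simp add: cong_Lam)
qed

text \<open>The equation for a variable passes to any \<open>a\<close> by applying
  \<open>Lam F ?b\<close> and \<open>Lam F (Var 0)\<close> to \<open>a\<close>: congruence equates
  the two applications, and \<open>beta_Imp\<close> evaluates each of them.\<close>

lemma retraction_app: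
  assumes r: "retraction \<phi> \<psi> F G" and a: "\<Gamma> \<turnstile> a \<^bold>: F"
  shows "\<Gamma> \<turnstile> App \<psi> (App \<phi> a) \<approx> a \<^bold>: F"
proof -
  let ?b = "App \<psi> (App \<phi> (Var 0))"
  have ty: "F # \<Gamma> \<turnstile> ?b \<^bold>: F" and inst: "inst a ?b = App \<psi> (App \<phi> a)"
    using r unfolding retraction_def closed_arr_def by (simp_all add: typing_simps inst_def)
  have "\<Gamma> \<turnstile> App (Lam F ?b) a \<approx> App (Lam F (Var 0)) a \<^bold>: F"
    using r a unfolding retraction_def by (blast intro: cong_App cong_Lam eq_refl)
  moreover have "\<Gamma> \<turnstile> App (Lam F ?b) a \<approx> App \<psi> (App \<phi> a) \<^bold>: F"
    using beta_Imp[OF ty a] inst by simp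
  moreover have "\<Gamma> \<turnstile> App (Lam F (Var 0)) a \<approx> a \<^bold>: F"
    using beta_Imp[of F \<Gamma> "Var 0" F a] a by (simp add: typing_simps inst_def)
  ultimately show ?thesis by (metis eq_sym eq_trans)
qed

text \<open>\<open>numeral_eq_Suc\<close> turns the round counts of \<open>conv\<close> into
  successors, so that the iterates of \<open>dev\<close> unfold.\<close>

lemmas compute = closed_arr_def typing_simps inst_def numeral_eq_Suc

section \<open>The high-school identities\<close>

lemma And_comm: "closed_iso (And A B) (And B A)"
  by (rule closed_isoI[where \<phi> = "Lam (And A B) (MkPair (Snd (Var 0)) (Fst (Var 0)))"
        and \<psi> = "Lam (And B A) (MkPair (Snd (Var 0)) (Fst (Var 0)))"])
    (simp add: compute | rule conv[where n = 3])+

lemma And_assoc: "closed_iso (And (And A B) C) (And A (And B C))"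
  by (rule closed_isoI[where
        \<phi> = "Lam (And (And A B) C)
               (MkPair (Fst (Fst (Var 0))) (MkPair (Snd (Fst (Var 0))) (Snd (Var 0))))"
        and \<psi> = "Lam (And A (And B C))
               (MkPair (MkPair (Fst (Var 0)) (Fst (Snd (Var 0)))) (Snd (Snd (Var 0))))"])
    (simp add: compute | rule conv[where n = 3])+

lemma And_Top: "closed_iso (And A Top) A"
proof (rule closed_isoI[where \<phi> = "Lam (And A Top) (Fst (Var 0))"
        and \<psi> = "Lam A (MkPair (Var 0) Star)"], goal_cases)
  case (3 \<Gamma>)
  \<comment> \<open>The round trip yields the pair of \<open>Fst (Var 0)\<close> and
    \<open>Star\<close>, which \<open>dev\<close> leaves alone; the second components agree by
    \<open>ext_Top\<close>.\<close>
  show ?case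
    by (rule ext_And) (simp add: compute | rule ext_Top | rule conv[where n = 3])+
qed (simp add: compute | rule conv[where n = 3])+

lemma Imp_Top: "closed_iso (Imp A Top) Top"
proof (rule closed_isoI[where \<phi> = "Lam (Imp A Top) Star"
        and \<psi> = "Lam Top (Lam A Star)"], goal_cases)
  case (3 \<Gamma>)
  show ?case
    by (rule ext_Imp) (simp add: compute | rule ext_Top)+
next
  case (4 \<Gamma>)
  show ?case
    by (rule ext_Top) (simp_all add: compute)
qed (simp_all add: compute)

lemma Top_Imp: "closed_iso (Imp Top A) A"
proof (rule closed_isoI[where \<phi> = "Lam (Imp Top A) (App (Var 0) Star)"
        and \<psi> = "Lam A (Lam Top (Var (Suc 0)))"], goal_cases)
  case (3 \<Gamma>)
  let ?\<Gamma> = "Top # Imp Top A # \<Gamma>"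
  \<comment> \<open>Reduction does not identify a variable of type \<open>Top\<close> with
    \<open>Star\<close>; this step does, by \<open>ext_Top\<close> below the application.\<close>
  have "?\<Gamma> \<turnstile> App (Var (Suc 0)) Star \<approx> App (Var (Suc 0)) (Var 0) \<^bold>: A"
    by (rule cong_App[where A = Top]; (rule eq_refl ext_Top)?; simp add: typing_simps)
  moreover have "?\<Gamma> \<turnstile> App (App (Lam A (Lam Top (Var (Suc 0))))
      (App (Lam (Imp Top A) (App (Var 0) Star)) (Var (Suc 0)))) (Var 0)
      \<approx> App (Var (Suc 0)) Star \<^bold>: A"
    by (rule conv[where n = 3]) (simp_all add: compute)
  ultimately show ?case
    by (intro ext_Imp) (auto simp: compute intro: eq_trans)
qed (simp add: compute | rule conv[where n = 3])+

lemma curry: "closed_iso (Imp A (Imp B C)) (Imp (And A B) C)"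
proof (rule closed_isoI[where
        \<phi> = "Lam (Imp A (Imp B C)) (Lam (And A B)
               (App (App (Var (Suc 0)) (Fst (Var 0))) (Snd (Var 0))))"
        and \<psi> = "Lam (Imp (And A B) C) (Lam A (Lam B
               (App (Var (Suc (Suc 0))) (MkPair (Var (Suc 0)) (Var 0)))))"], goal_cases)
  case (3 \<Gamma>)
  show ?case
    by (rule ext_Imp, simp_all add: compute, rule ext_Imp)
      (simp add: compute | rule conv[where n = 5])+
next
  case (4 \<Gamma>)
  show ?case
    \<comment> \<open>The argument comes back as the pair of its projections, which
      \<open>dev\<close> contracts.\<close>
    by (rule ext_Imp) (simp add: compute | rule conv[where n = 5])+
qed (simp_all add: compute)

lemma Imp_And: "closed_iso (Imp A (And B C)) (And (Imp A B) (Imp A C))"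
proof (rule closed_isoI[where
        \<phi> = "Lam (Imp A (And B C)) (MkPair (Lam A (Fst (App (Var (Suc 0)) (Var 0))))
               (Lam A (Snd (App (Var (Suc 0)) (Var 0)))))"
        and \<psi> = "Lam (And (Imp A B) (Imp A C)) (Lam A
               (MkPair (App (Fst (Var (Suc 0))) (Var 0)) (App (Snd (Var (Suc 0))) (Var 0))))"],
      goal_cases)
  case (3 \<Gamma>)
  show ?case
    by (rule ext_Imp) (simp add: compute | rule conv[where n = 5])+
next
  case (4 \<Gamma>)
  show ?case
    by (rule ext_And; (rule ext_Imp)?) (simp add: compute | rule conv[where n = 5])+
qed (simp_all add: compute)

lemma Imp_Or: "closed_iso (Imp (Or A B) C) (And (Imp A C) (Imp B C))"
proof (rule closed_isoI[where
        \<phi> = "Lam (Imp (Or A B) C) (MkPair (Lam A (App (Var (Suc 0)) (InL B (Var 0))))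
               (Lam B (App (Var (Suc 0)) (InR A (Var 0)))))"
        and \<psi> = "Lam (And (Imp A C) (Imp B C)) (Lam (Or A B) (Case (Var 0)
               (App (Fst (Var (Suc (Suc 0)))) (Var 0)) (App (Snd (Var (Suc (Suc 0)))) (Var 0))))"],
      goal_cases)
  case (3 \<Gamma>)
  \<comment> \<open>The index of the function is a parameter: it is \<open>Suc 0\<close> in the
    goal, but one higher in the term that \<open>ext_Or\<close> abstracts over the sum.\<close>
  let ?t = "\<lambda>i. App (App (Lam (And (Imp A C) (Imp B C)) (Lam (Or A B) (Case (Var 0)
               (App (Fst (Var (Suc (Suc 0)))) (Var 0)) (App (Snd (Var (Suc (Suc 0)))) (Var 0)))))
      (App (Lam (Imp (Or A B) C) (MkPair (Lam A (App (Var (Suc 0)) (InL B (Var 0))))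
               (Lam B (App (Var (Suc 0)) (InR A (Var 0)))))) (Var i))) (Var 0)"
  have "Or A B # Imp (Or A B) C # \<Gamma> \<turnstile> ?t (Suc 0) \<approx> App (Var (Suc 0)) (Var 0) \<^bold>: C"
    by (rule ext_Or[where u = "Var 0" and t = "?t (Suc (Suc 0))"
          and t' = "App (Var (Suc (Suc 0))) (Var 0)" and A = A and B = B])
      (simp add: compute | rule conv[where n = 5])+
  then show ?case
    by (intro ext_Imp) (simp_all add: compute)
next
  case (4 \<Gamma>)
  show ?case
    by (rule ext_And; (rule ext_Imp)?) (simp add: compute | rule conv[where n = 5])+
qed (simp_all add: compute)

lemma Or_assoc: "closed_iso (Or (Or A B) C) (Or A (Or B C))"
proof (rule closed_isoI[where
        \<phi> = "Lam (Or (Or A B) C) (Case (Var 0)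
               (Case (Var 0) (InL (Or B C) (Var 0)) (InR A (InL C (Var 0))))
               (InR A (InR B (Var 0))))"
        and \<psi> = "Lam (Or A (Or B C)) (Case (Var 0)
               (InL C (InL B (Var 0)))
               (Case (Var 0) (InL C (InR A (Var 0))) (InR (Or A B) (Var 0))))"], goal_cases)
  case (3 \<Gamma>)
  let ?f = "\<lambda>t. App (Lam (Or A (Or B C)) (Case (Var 0)
               (InL C (InL B (Var 0)))
               (Case (Var 0) (InL C (InR A (Var 0))) (InR (Or A B) (Var 0)))))
      (App (Lam (Or (Or A B) C) (Case (Var 0)
               (Case (Var 0) (InL (Or B C) (Var 0)) (InR A (InL C (Var 0))))
               (InR A (InR B (Var 0))))) t)"
  \<comment> \<open>The left branch of the outer split still holds a variable of type
    \<open>Or A B\<close>. Its own split is prepared here, in the form that the outer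
    \<open>ext_Or\<close> produces.\<close>
  have *: "Or A B # Or (Or A B) C # \<Gamma> \<turnstile> ?f (InL C (Var 0)) \<approx> InL C (Var 0) \<^bold>: Or (Or A B) C"
    by (rule ext_Or[where u = "Var 0" and t = "?f (InL C (Var 0))" and t' = "InL C (Var 0)"
          and A = A and B = B])
      (simp add: compute | rule conv[where n = 5])+
  show ?case
    by (rule ext_Or[where u = "Var 0" and t = "?f (Var 0)" and t' = "Var 0"
          and A = "Or A B" and B = C])
      (simp add: compute * | rule conv[where n = 5])+
next
  case (4 \<Gamma>)
  let ?f = "\<lambda>t. App (Lam (Or (Or A B) C) (Case (Var 0)
               (Case (Var 0) (InL (Or B C) (Var 0)) (InR A (InL C (Var 0))))
               (InR A (InR B (Var 0)))))
      (App (Lam (Or A (Or B C)) (Case (Var 0)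
               (InL C (InL B (Var 0)))
               (Case (Var 0) (InL C (InR A (Var 0))) (InR (Or A B) (Var 0))))) t)"
  have *: "Or B C # Or A (Or B C) # \<Gamma> \<turnstile> ?f (InR A (Var 0)) \<approx> InR A (Var 0) \<^bold>: Or A (Or B C)"
    by (rule ext_Or[where u = "Var 0" and t = "?f (InR A (Var 0))" and t' = "InR A (Var 0)"
          and A = B and B = C])
      (simp add: compute | rule conv[where n = 5])+
  show ?case
    by (rule ext_Or[where u = "Var 0" and t = "?f (Var 0)" and t' = "Var 0"
          and A = A and B = "Or B C"])
      (simp add: compute * | rule conv[where n = 5])+
qed (simp_all add: compute)

lemma And_Or: "closed_iso (And (Or A B) C) (Or (And A C) (And B C))"
proof (rule closed_isoI[where
        \<phi> = "Lam (And (Or A B) C) (Case (Fst (Var 0))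
               (InL (And B C) (MkPair (Var 0) (Snd (Var (Suc 0)))))
               (InR (And A C) (MkPair (Var 0) (Snd (Var (Suc 0))))))"
        and \<psi> = "Lam (Or (And A C) (And B C)) (Case (Var 0)
               (MkPair (InL B (Fst (Var 0))) (Snd (Var 0)))
               (MkPair (InR A (Fst (Var 0))) (Snd (Var 0))))"], goal_cases)
  case (3 \<Gamma>)
  let ?f = "\<lambda>t. App (Lam (Or (And A C) (And B C)) (Case (Var 0)
               (MkPair (InL B (Fst (Var 0))) (Snd (Var 0)))
               (MkPair (InR A (Fst (Var 0))) (Snd (Var 0)))))
      (App (Lam (And (Or A B) C) (Case (Fst (Var 0))
               (InL (And B C) (MkPair (Var 0) (Snd (Var (Suc 0)))))
               (InR (And A C) (MkPair (Var 0) (Snd (Var (Suc 0))))))) t)"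
  \<comment> \<open>\<open>?x\<close> is the eta expansion of the variable and exposes the sum
    \<open>Fst (Var 0)\<close> as a subterm to split on. \<open>?y\<close> is \<open>?x\<close> with
    that subterm abstracted, which raises the remaining variable by one.\<close>
  let ?x = "MkPair (Fst (Var 0)) (Snd (Var 0))"
  let ?y = "MkPair (Var 0) (Snd (Var (Suc 0)))"
  have "And (Or A B) C # \<Gamma> \<turnstile> ?f ?x \<approx> ?x \<^bold>: And (Or A B) C"
    by (rule ext_Or[where u = "Fst (Var 0)" and t = "?f ?y" and t' = ?y and A = A and B = B])
      (simp add: compute | rule conv[where n = 5])+
  moreover have "And (Or A B) C # \<Gamma> \<turnstile> ?f (Var 0) \<approx> ?f ?x \<^bold>: And (Or A B) C"
    by (rule conv[where n = 1]) (simp_all add: compute)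
  moreover have "And (Or A B) C # \<Gamma> \<turnstile> ?x \<approx> Var 0 \<^bold>: And (Or A B) C"
    by (rule conv[where n = 1]) (simp_all add: compute)
  ultimately show ?case by (blast intro: eq_trans)
next
  case (4 \<Gamma>)
  let ?f = "\<lambda>t. App (Lam (And (Or A B) C) (Case (Fst (Var 0))
               (InL (And B C) (MkPair (Var 0) (Snd (Var (Suc 0)))))
               (InR (And A C) (MkPair (Var 0) (Snd (Var (Suc 0)))))))
      (App (Lam (Or (And A C) (And B C)) (Case (Var 0)
               (MkPair (InL B (Fst (Var 0))) (Snd (Var 0)))
               (MkPair (InR A (Fst (Var 0))) (Snd (Var 0))))) t)"
  show ?case
    by (rule ext_Or[where u = "Var 0" and t = "?f (Var 0)" and t' = "Var 0"
          and A = "And A C" and B = "And B C"])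
      (simp add: compute | rule conv[where n = 5])+
qed (simp_all add: compute)

section \<open>Equivalence and congruence\<close>

lemma subst_rename: "subst s (rename r t) = subst (\<lambda>i. s (r i)) t" for s :: "nat \<Rightarrow> 'p tm"
proof -
  have *: "(\<lambda>i. up_sub s (up_ren r i)) = up_sub (\<lambda>i. s (r i))" for s :: "nat \<Rightarrow> 'p tm" and r
    by (rule ext) (simp add: up_sub_def up_ren_def split: nat.split)
  show ?thesis by (induction t arbitrary: s r) (simp_all add: *)
qed

lemma subst_Var [simp]: "subst Var t = t"
proof -
  have *: "up_sub Var = Var"
    by (rule ext) (simp add: up_sub_def split: nat.split)
  show ?thesis by (induction t) (simp_all add: *)
qed

text \<open>Serves where a term is moved under a binder that is then instantiated, as in
  \<open>Imp_tm_App\<close>.\<close>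

lemma inst_weaken: "inst u (rename Suc t) = t"
  by (simp add: inst_def subst_rename)

text \<open>The reduct is given by an equation, so that the simplifier can compute the
  instance.\<close>

lemma beta_Imp': "A # \<Gamma> \<turnstile> t \<^bold>: B \<Longrightarrow> \<Gamma> \<turnstile> u \<^bold>: A \<Longrightarrow> inst u t = v \<Longrightarrow> \<Gamma> \<turnstile> App (Lam A t) u \<approx> v \<^bold>: B"
  using beta_Imp by blast

lemma closed_arrD:
  assumes "closed_arr \<phi> F G"
  shows "\<Gamma> \<turnstile> \<phi> \<^bold>: T \<longleftrightarrow> T = Imp F G" "rename r \<phi> = \<phi>" "subst s \<phi> = \<phi>"
  using assms unfolding closed_arr_def by simp_all

lemma cong_closed_arr: "closed_arr \<phi> F G \<Longrightarrow> \<Gamma> \<turnstile> a \<approx> b \<^bold>: F \<Longrightarrow> \<Gamma> \<turnstile> App \<phi> a \<approx> App \<phi> b \<^bold>: G"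
  by (rule cong_App[OF eq_refl]) (simp_all add: closed_arrD)

lemma retractionD:
  assumes "retraction \<phi> \<psi> F G"
  shows "closed_arr \<phi> F G" "closed_arr \<psi> G F"
  using assms unfolding retraction_def by simp_all

lemma retractionI:
  assumes "closed_arr \<phi> F G" "closed_arr \<psi> G F"
    "\<And>\<Gamma>. F # \<Gamma> \<turnstile> App \<psi> (App \<phi> (Var 0)) \<approx> Var 0 \<^bold>: F"
  shows "retraction \<phi> \<psi> F G"
  using assms unfolding retraction_def by blast

section \<open>Retractions under composition and under the connectives\<close>

declare eq_trans [trans]

definition comp_tm :: "'p fm \<Rightarrow> 'p tm \<Rightarrow> 'p tm \<Rightarrow> 'p tm" where
  "comp_tm F \<phi>1 \<phi>2 = Lam F (App \<phi>2 (App \<phi>1 (Var 0)))"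

text \<open>The inner pair \<open>\<phi>2\<close>, \<open>\<psi>2\<close> cancels first, which
  brings \<open>\<phi>1\<close> and \<open>\<psi>1\<close> together.\<close>

lemma retraction_comp:
  assumes 1: "retraction \<phi>1 \<psi>1 F G" and 2: "retraction \<phi>2 \<psi>2 G H"
  shows "retraction (comp_tm F \<phi>1 \<phi>2) (comp_tm H \<psi>2 \<psi>1) F H"
proof (rule retractionI)
  note arr = closed_arrD[OF retractionD(1)[OF 1]] closed_arrD[OF retractionD(2)[OF 1]]
    closed_arrD[OF retractionD(1)[OF 2]] closed_arrD[OF retractionD(2)[OF 2]]
  show arr_comp: "closed_arr (comp_tm F \<phi>1 \<phi>2) F H" "closed_arr (comp_tm H \<psi>2 \<psi>1) H F"
    by (simp_all add: closed_arr_def comp_tm_def typing_simps arr)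
  fix \<Gamma>
  let ?\<Gamma> = "F # \<Gamma>" and ?x = "Var 0 :: 'a tm"
  have "?\<Gamma> \<turnstile> App (comp_tm F \<phi>1 \<phi>2) ?x \<approx> App \<phi>2 (App \<phi>1 ?x) \<^bold>: H"
    unfolding comp_tm_def by (rule beta_Imp') (simp_all add: typing_simps arr inst_def)
  then have "?\<Gamma> \<turnstile> App (comp_tm H \<psi>2 \<psi>1) (App (comp_tm F \<phi>1 \<phi>2) ?x)
      \<approx> App (comp_tm H \<psi>2 \<psi>1) (App \<phi>2 (App \<phi>1 ?x)) \<^bold>: F"
    by (rule cong_closed_arr[OF arr_comp(2)])
  also have "?\<Gamma> \<turnstile> App (comp_tm H \<psi>2 \<psi>1) (App \<phi>2 (App \<phi>1 ?x))
      \<approx> App \<psi>1 (App \<psi>2 (App \<phi>2 (App \<phi>1 ?x))) \<^bold>: F"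
    unfolding comp_tm_def by (rule beta_Imp') (simp_all add: typing_simps arr inst_def)
  also have "?\<Gamma> \<turnstile> App \<psi>1 (App \<psi>2 (App \<phi>2 (App \<phi>1 ?x))) \<approx> App \<psi>1 (App \<phi>1 ?x) \<^bold>: F"
    by (intro cong_closed_arr[OF retractionD(2)[OF 1]] retraction_app[OF 2])
      (simp add: typing_simps arr)
  also have "?\<Gamma> \<turnstile> App \<psi>1 (App \<phi>1 ?x) \<approx> ?x \<^bold>: F"
    by (rule retraction_app[OF 1]) (simp add: typing_simps)
  finally show "?\<Gamma> \<turnstile> App (comp_tm H \<psi>2 \<psi>1) (App (comp_tm F \<phi>1 \<phi>2) ?x) \<approx> ?x \<^bold>: F" .
qed

definition And_tm :: "'p fm \<Rightarrow> 'p fm \<Rightarrow> 'p tm \<Rightarrow> 'p tm \<Rightarrow> 'p tm" where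
  "And_tm F G \<phi>1 \<phi>2 = Lam (And F G) (MkPair (App \<phi>1 (Fst (Var 0))) (App \<phi>2 (Snd (Var 0))))"

text \<open>The round trip acts on each projection separately, and \<open>eta_And\<close>
  reassembles the variable.\<close>

lemma retraction_And:
  assumes 1: "retraction \<phi>1 \<psi>1 F F'" and 2: "retraction \<phi>2 \<psi>2 G G'"
  shows "retraction (And_tm F G \<phi>1 \<phi>2) (And_tm F' G' \<psi>1 \<psi>2) (And F G) (And F' G')"
proof (rule retractionI)
  note arr = closed_arrD[OF retractionD(1)[OF 1]] closed_arrD[OF retractionD(2)[OF 1]]
    closed_arrD[OF retractionD(1)[OF 2]] closed_arrD[OF retractionD(2)[OF 2]]
  show arr_And: "closed_arr (And_tm F G \<phi>1 \<phi>2) (And F G) (And F' G')"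
    "closed_arr (And_tm F' G' \<psi>1 \<psi>2) (And F' G') (And F G)"
    by (simp_all add: closed_arr_def And_tm_def typing_simps arr)
  fix \<Gamma>
  let ?\<Gamma> = "And F G # \<Gamma>" and ?x = "Var 0 :: 'a tm"
  let ?a = "App \<phi>1 (Fst ?x)" and ?b = "App \<phi>2 (Snd ?x)"
  have ty: "?\<Gamma> \<turnstile> ?a \<^bold>: F'" "?\<Gamma> \<turnstile> ?b \<^bold>: G'"
    by (simp_all add: typing_simps arr)
  have "?\<Gamma> \<turnstile> App (And_tm F G \<phi>1 \<phi>2) ?x \<approx> MkPair ?a ?b \<^bold>: And F' G'"
    unfolding And_tm_def by (rule beta_Imp') (simp_all add: typing_simps arr inst_def)
  then have "?\<Gamma> \<turnstile> App (And_tm F' G' \<psi>1 \<psi>2) (App (And_tm F G \<phi>1 \<phi>2) ?x)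
      \<approx> App (And_tm F' G' \<psi>1 \<psi>2) (MkPair ?a ?b) \<^bold>: And F G"
    by (rule cong_closed_arr[OF arr_And(2)])
  also have "?\<Gamma> \<turnstile> App (And_tm F' G' \<psi>1 \<psi>2) (MkPair ?a ?b)
      \<approx> MkPair (App \<psi>1 (Fst (MkPair ?a ?b))) (App \<psi>2 (Snd (MkPair ?a ?b))) \<^bold>: And F G"
    unfolding And_tm_def by (rule beta_Imp') (simp_all add: typing_simps arr inst_def)
  also have "?\<Gamma> \<turnstile> MkPair (App \<psi>1 (Fst (MkPair ?a ?b))) (App \<psi>2 (Snd (MkPair ?a ?b)))
      \<approx> MkPair (App \<psi>1 ?a) (App \<psi>2 ?b) \<^bold>: And F G"
    by (intro cong_MkPair cong_closed_arr[OF retractionD(2)[OF 1]]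
        cong_closed_arr[OF retractionD(2)[OF 2]] beta_Fst[OF ty] beta_Snd[OF ty])
  also have "?\<Gamma> \<turnstile> MkPair (App \<psi>1 ?a) (App \<psi>2 ?b) \<approx> MkPair (Fst ?x) (Snd ?x) \<^bold>: And F G"
    by (intro cong_MkPair retraction_app[OF 1] retraction_app[OF 2]) (simp_all add: typing_simps)
  also have "?\<Gamma> \<turnstile> MkPair (Fst ?x) (Snd ?x) \<approx> ?x \<^bold>: And F G"
    by (rule eta_And) (simp add: typing_simps)
  finally show "?\<Gamma> \<turnstile> App (And_tm F' G' \<psi>1 \<psi>2) (App (And_tm F G \<phi>1 \<phi>2) ?x) \<approx> ?x \<^bold>: And F G" .
qed

text \<open>The target formulas are parameters because each injection is annotated with the opposite
  summand.\<close>

definition Or_tm :: "'p fm \<Rightarrow> 'p fm \<Rightarrow> 'p fm \<Rightarrow> 'p fm \<Rightarrow> 'p tm \<Rightarrow> 'p tm \<Rightarrow> 'p tm" where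
  "Or_tm F F' G G' \<phi>1 \<phi>2 =
     Lam (Or F G) (Case (Var 0) (InL G' (App \<phi>1 (Var 0))) (InR F' (App \<phi>2 (Var 0))))"

lemma closed_arr_Or_tm:
  assumes "closed_arr \<phi>1 F F'" "closed_arr \<phi>2 G G'"
  shows "closed_arr (Or_tm F F' G G' \<phi>1 \<phi>2) (Or F G) (Or F' G')"
  by (simp add: closed_arr_def Or_tm_def typing_simps closed_arrD[OF assms(1)] closed_arrD[OF assms(2)])

lemma Or_tm_InL:
  assumes "closed_arr \<phi>1 F F'" "closed_arr \<phi>2 G G'" "\<Gamma> \<turnstile> a \<^bold>: F"
  shows "\<Gamma> \<turnstile> App (Or_tm F F' G G' \<phi>1 \<phi>2) (InL G a) \<approx> InL G' (App \<phi>1 a) \<^bold>: Or F' G'"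
proof -
  note arr = closed_arrD[OF assms(1)] closed_arrD[OF assms(2)]
  have "\<Gamma> \<turnstile> App (Or_tm F F' G G' \<phi>1 \<phi>2) (InL G a)
      \<approx> Case (InL G a) (InL G' (App \<phi>1 (Var 0))) (InR F' (App \<phi>2 (Var 0))) \<^bold>: Or F' G'"
    unfolding Or_tm_def by (rule beta_Imp') (simp_all add: typing_simps arr inst_def assms(3))
  also have "\<Gamma> \<turnstile> Case (InL G a) (InL G' (App \<phi>1 (Var 0))) (InR F' (App \<phi>2 (Var 0)))
      \<approx> inst a (InL G' (App \<phi>1 (Var 0))) \<^bold>: Or F' G'"
    by (rule beta_InL[OF assms(3)]) (simp_all add: typing_simps arr)
  finally show ?thesis by (simp add: inst_def arr)
qed

lemma Or_tm_InR:
  assumes "closed_arr \<phi>1 F F'" "closed_arr \<phi>2 G G'" "\<Gamma> \<turnstile> b \<^bold>: G"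
  shows "\<Gamma> \<turnstile> App (Or_tm F F' G G' \<phi>1 \<phi>2) (InR F b) \<approx> InR F' (App \<phi>2 b) \<^bold>: Or F' G'"
proof -
  note arr = closed_arrD[OF assms(1)] closed_arrD[OF assms(2)]
  have "\<Gamma> \<turnstile> App (Or_tm F F' G G' \<phi>1 \<phi>2) (InR F b)
      \<approx> Case (InR F b) (InL G' (App \<phi>1 (Var 0))) (InR F' (App \<phi>2 (Var 0))) \<^bold>: Or F' G'"
    unfolding Or_tm_def by (rule beta_Imp') (simp_all add: typing_simps arr inst_def assms(3))
  also have "\<Gamma> \<turnstile> Case (InR F b) (InL G' (App \<phi>1 (Var 0))) (InR F' (App \<phi>2 (Var 0)))
      \<approx> inst b (InR F' (App \<phi>2 (Var 0))) \<^bold>: Or F' G'"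
    by (rule beta_InR[OF assms(3)]) (simp_all add: typing_simps arr)
  finally show ?thesis by (simp add: inst_def arr)
qed

text \<open>By \<open>ext_Or\<close> it is enough to follow the round trip on the two injections,
  where \<open>Or_tm_InL\<close> and \<open>Or_tm_InR\<close> compute it.\<close>

lemma retraction_Or:
  assumes 1: "retraction \<phi>1 \<psi>1 F F'" and 2: "retraction \<phi>2 \<psi>2 G G'"
  shows "retraction (Or_tm F F' G G' \<phi>1 \<phi>2) (Or_tm F' F G' G \<psi>1 \<psi>2) (Or F G) (Or F' G')"
proof (rule retractionI)
  note r = retractionD[OF 1] retractionD[OF 2]
  note arr = r[THEN closed_arrD(1)] r[THEN closed_arrD(2)] r[THEN closed_arrD(3)]
  let ?\<Phi> = "Or_tm F F' G G' \<phi>1 \<phi>2" and ?\<Psi> = "Or_tm F' F G' G \<psi>1 \<psi>2"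
  show arr_Or: "closed_arr ?\<Phi> (Or F G) (Or F' G')" "closed_arr ?\<Psi> (Or F' G') (Or F G)"
    using r by (blast intro: closed_arr_Or_tm)+
  note arr' = arr_Or[THEN closed_arrD(1)] arr_Or[THEN closed_arrD(2)] arr_Or[THEN closed_arrD(3)]
  fix \<Gamma>
  let ?x = "Var 0 :: 'a tm"
  \<comment> \<open>The sum variable stays in the context behind the branch variable, as in the
    premises of \<open>ext_Or\<close>.\<close>
  have L: "F # Or F G # \<Gamma> \<turnstile> App ?\<Psi> (App ?\<Phi> (InL G ?x)) \<approx> InL G ?x \<^bold>: Or F G"
  proof -
    let ?\<Gamma> = "F # Or F G # \<Gamma>"
    have "?\<Gamma> \<turnstile> App ?\<Psi> (App ?\<Phi> (InL G ?x)) \<approx> App ?\<Psi> (InL G' (App \<phi>1 ?x)) \<^bold>: Or F G"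
      by (intro cong_closed_arr[OF arr_Or(2)] Or_tm_InL r) (simp add: typing_simps)
    also have "?\<Gamma> \<turnstile> App ?\<Psi> (InL G' (App \<phi>1 ?x)) \<approx> InL G (App \<psi>1 (App \<phi>1 ?x)) \<^bold>: Or F G"
      by (intro Or_tm_InL r) (simp add: typing_simps arr)
    also have "?\<Gamma> \<turnstile> InL G (App \<psi>1 (App \<phi>1 ?x)) \<approx> InL G ?x \<^bold>: Or F G"
      by (intro cong_InL retraction_app[OF 1]) (simp add: typing_simps)
    finally show ?thesis .
  qed
  have R: "G # Or F G # \<Gamma> \<turnstile> App ?\<Psi> (App ?\<Phi> (InR F ?x)) \<approx> InR F ?x \<^bold>: Or F G"
  proof -
    let ?\<Gamma> = "G # Or F G # \<Gamma>"
    have "?\<Gamma> \<turnstile> App ?\<Psi> (App ?\<Phi> (InR F ?x)) \<approx> App ?\<Psi> (InR F' (App \<phi>2 ?x)) \<^bold>: Or F G"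
      by (intro cong_closed_arr[OF arr_Or(2)] Or_tm_InR r) (simp add: typing_simps)
    also have "?\<Gamma> \<turnstile> App ?\<Psi> (InR F' (App \<phi>2 ?x)) \<approx> InR F (App \<psi>2 (App \<phi>2 ?x)) \<^bold>: Or F G"
      by (intro Or_tm_InR r) (simp add: typing_simps arr)
    also have "?\<Gamma> \<turnstile> InR F (App \<psi>2 (App \<phi>2 ?x)) \<approx> InR F ?x \<^bold>: Or F G"
      by (intro cong_InR retraction_app[OF 2]) (simp add: typing_simps)
    finally show ?thesis .
  qed
  show "Or F G # \<Gamma> \<turnstile> App ?\<Psi> (App ?\<Phi> ?x) \<approx> ?x \<^bold>: Or F G"
    by (rule ext_Or[where u = ?x and t = "App ?\<Psi> (App ?\<Phi> ?x)" and t' = ?x and A = F and B = G])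
      (simp_all add: typing_simps arr' inst_def L R)
qed

text \<open>Contravariant in the exponent: precomposition with \<open>\<psi>1\<close>, which goes
  from \<open>F'\<close> back to \<open>F\<close>, and postcomposition with
  \<open>\<phi>2\<close>.\<close>

definition Imp_tm :: "'p fm \<Rightarrow> 'p fm \<Rightarrow> 'p fm \<Rightarrow> 'p tm \<Rightarrow> 'p tm \<Rightarrow> 'p tm" where
  "Imp_tm F F' G \<psi>1 \<phi>2 =
     Lam (Imp F G) (Lam F' (App \<phi>2 (App (Var (Suc 0)) (App \<psi>1 (Var 0)))))"

lemma closed_arr_Imp_tm:
  assumes "closed_arr \<psi>1 F' F" "closed_arr \<phi>2 G G'"
  shows "closed_arr (Imp_tm F F' G \<psi>1 \<phi>2) (Imp F G) (Imp F' G')"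
  by (auto simp: closed_arr_def Imp_tm_def typing_simps closed_arrD[OF assms(1)] closed_arrD[OF assms(2)])

lemma Imp_tm_App:
  assumes "closed_arr \<psi>1 F' F" "closed_arr \<phi>2 G G'" and f: "\<Gamma> \<turnstile> f \<^bold>: Imp F G" and x: "\<Gamma> \<turnstile> x \<^bold>: F'"
  shows "\<Gamma> \<turnstile> App (App (Imp_tm F F' G \<psi>1 \<phi>2) f) x \<approx> App \<phi>2 (App f (App \<psi>1 x)) \<^bold>: G'"
proof -
  note arr = closed_arrD[OF assms(1)] closed_arrD[OF assms(2)]
  let ?b = "App \<phi>2 (App (rename Suc f) (App \<psi>1 (Var 0)))"
  have ty: "F' # \<Gamma> \<turnstile> ?b \<^bold>: G'"
    using typing_weaken[OF f, of F'] by (auto simp: typing_simps arr)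
  have "\<Gamma> \<turnstile> App (Imp_tm F F' G \<psi>1 \<phi>2) f \<approx> Lam F' ?b \<^bold>: Imp F' G'"
    unfolding Imp_tm_def by (rule beta_Imp') (auto simp: typing_simps arr inst_def f)
  then have "\<Gamma> \<turnstile> App (App (Imp_tm F F' G \<psi>1 \<phi>2) f) x \<approx> App (Lam F' ?b) x \<^bold>: G'"
    using x by (blast intro: cong_App eq_refl)
  also have "\<Gamma> \<turnstile> App (Lam F' ?b) x \<approx> App \<phi>2 (App f (App \<psi>1 x)) \<^bold>: G'"
    \<comment> \<open>The first reduction weakened \<open>f\<close> to carry it under the inner
      \<open>Lam\<close>; the second undoes this.\<close>
    using inst_weaken[of x f] by (intro beta_Imp'[OF ty x]) (simp add: inst_def arr)
  finally show ?thesis .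
qed

text \<open>Applied to an argument \<open>x\<close>, the round trip becomes
  \<open>\<psi>2 (\<phi>2 (f (\<psi>1 (\<phi>1 x))))\<close>, so despite contravariance both
  hypotheses are used in the direction given.\<close>

lemma retraction_Imp:
  assumes 1: "retraction \<phi>1 \<psi>1 F F'" and 2: "retraction \<phi>2 \<psi>2 G G'"
  shows "retraction (Imp_tm F F' G \<psi>1 \<phi>2) (Imp_tm F' F G' \<phi>1 \<psi>2) (Imp F G) (Imp F' G')"
proof (rule retractionI)
  note r = retractionD[OF 1] retractionD[OF 2]
  note arr = r[THEN closed_arrD(1)] r[THEN closed_arrD(2)] r[THEN closed_arrD(3)]
  let ?\<Phi> = "Imp_tm F F' G \<psi>1 \<phi>2" and ?\<Psi> = "Imp_tm F' F G' \<phi>1 \<psi>2"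
  show arr_Imp: "closed_arr ?\<Phi> (Imp F G) (Imp F' G')" "closed_arr ?\<Psi> (Imp F' G') (Imp F G)"
    using r by (blast intro: closed_arr_Imp_tm)+
  note arr' = arr_Imp[THEN closed_arrD(1)] arr_Imp[THEN closed_arrD(2)]
  fix \<Gamma>
  let ?\<Gamma> = "F # Imp F G # \<Gamma>" and ?f = "Var (Suc 0) :: 'a tm" and ?x = "Var 0 :: 'a tm"
  have "?\<Gamma> \<turnstile> App (App ?\<Psi> (App ?\<Phi> ?f)) ?x \<approx> App \<psi>2 (App (App ?\<Phi> ?f) (App \<phi>1 ?x)) \<^bold>: G"
    by (intro Imp_tm_App r) (simp_all add: typing_simps arr')
  also have "?\<Gamma> \<turnstile> App \<psi>2 (App (App ?\<Phi> ?f) (App \<phi>1 ?x))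
      \<approx> App \<psi>2 (App \<phi>2 (App ?f (App \<psi>1 (App \<phi>1 ?x)))) \<^bold>: G"
    by (intro cong_closed_arr[OF r(4)] Imp_tm_App r) (simp_all add: typing_simps arr)
  also have "?\<Gamma> \<turnstile> App \<psi>2 (App \<phi>2 (App ?f (App \<psi>1 (App \<phi>1 ?x))))
      \<approx> App ?f (App \<psi>1 (App \<phi>1 ?x)) \<^bold>: G"
    by (rule retraction_app[OF 2]) (simp add: typing_simps arr)
  also have "?\<Gamma> \<turnstile> App ?f (App \<psi>1 (App \<phi>1 ?x)) \<approx> App ?f ?x \<^bold>: G"
    by (rule cong_App[OF eq_refl retraction_app[OF 1]]) (simp_all add: typing_simps)
  finally show "Imp F G # \<Gamma> \<turnstile> App ?\<Psi> (App ?\<Phi> (Var 0)) \<approx> Var 0 \<^bold>: Imp F G"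
    by (intro ext_Imp) (simp_all add: typing_simps arr')
qed

lemma closed_iso_refl: "closed_iso F F"
  by (rule closed_isoI[where \<phi> = "Lam F (Var 0)" and \<psi> = "Lam F (Var 0)"])
    (simp add: compute | rule conv[where n = 3])+

lemma closed_iso_sym: "closed_iso F G \<Longrightarrow> closed_iso G F"
  unfolding closed_iso_def by blast

lemma closed_iso_trans [trans]: "closed_iso F G \<Longrightarrow> closed_iso G H \<Longrightarrow> closed_iso F H"
  unfolding closed_iso_def by (blast intro: retraction_comp)

lemma closed_iso_And: "closed_iso F F' \<Longrightarrow> closed_iso G G' \<Longrightarrow> closed_iso (And F G) (And F' G')"
  unfolding closed_iso_def by (blast intro: retraction_And)

lemma closed_iso_Or: "closed_iso F F' \<Longrightarrow> closed_iso G G' \<Longrightarrow> closed_iso (Or F G) (Or F' G')"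
  unfolding closed_iso_def by (blast intro: retraction_Or)

lemma closed_iso_Imp: "closed_iso F F' \<Longrightarrow> closed_iso G G' \<Longrightarrow> closed_iso (Imp F G) (Imp F' G')"
  unfolding closed_iso_def by (blast intro: retraction_Imp)

section \<open>Normal forms\<close>

definition iso_to_C :: "'p fm \<Rightarrow> bool" where
  "iso_to_C F \<longleftrightarrow> (\<exists>c \<in> C_forms. closed_iso F c)"

definition iso_to_sum :: "'p fm \<Rightarrow> bool" where
  "iso_to_sum F \<longleftrightarrow> (\<exists>cs. cs \<noteq> [] \<and> set cs \<subseteq> C_forms \<and> closed_iso F (big_or cs))"

lemma iso_to_C_cong: "closed_iso F G \<Longrightarrow> iso_to_C G \<Longrightarrow> iso_to_C F"
  unfolding iso_to_C_def by (blast intro: closed_iso_trans)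

lemma iso_to_sum_cong: "closed_iso F G \<Longrightarrow> iso_to_sum G \<Longrightarrow> iso_to_sum F"
  unfolding iso_to_sum_def by (blast intro: closed_iso_trans)

lemma C_forms_iso_to_C: "c \<in> C_forms \<Longrightarrow> iso_to_C c"
  unfolding iso_to_C_def by (blast intro: closed_iso_refl)

lemma iso_to_C_imp_sum:
  assumes "iso_to_C F"
  shows "iso_to_sum F"
proof -
  from assms obtain c where "c \<in> C_forms" "closed_iso F c"
    unfolding iso_to_C_def by blast
  then have "[c] \<noteq> []" "set [c] \<subseteq> C_forms" "closed_iso F (big_or [c])"
    by simp_all
  then show ?thesis unfolding iso_to_sum_def by blast
qed

text \<open>Only an isomorphism, since a unary conjunction carries no final \<open>Top\<close>;
  \<open>And_Top\<close> bridges that case.\<close>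

lemma big_and_Cons: "closed_iso (big_and (A # As)) (And A (big_and As))"
  by (cases As) (simp_all add: closed_iso_refl closed_iso_sym[OF And_Top])

lemma big_or_Cons: "As \<noteq> [] \<Longrightarrow> big_or (A # As) = Or A (big_or As)"
  by (cases As) simp_all

lemma big_and_append: "closed_iso (And (big_and As) (big_and Bs)) (big_and (As @ Bs))"
proof (induction As)
  case Nil
  show ?case using closed_iso_trans[OF And_comm And_Top] by simp
next
  case (Cons A As)
  have "closed_iso (And (big_and (A # As)) (big_and Bs)) (And (And A (big_and As)) (big_and Bs))"
    by (intro closed_iso_And big_and_Cons closed_iso_refl)
  also have "closed_iso \<dots> (And A (And (big_and As) (big_and Bs)))"
    by (rule And_assoc)
  also have "closed_iso \<dots> (And A (big_and (As @ Bs)))"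
    by (intro closed_iso_And Cons.IH closed_iso_refl)
  also have "closed_iso \<dots> (big_and ((A # As) @ Bs))"
    by (simp add: closed_iso_sym[OF big_and_Cons])
  finally show ?case .
qed

lemma big_or_append:
  assumes "As \<noteq> []" "Bs \<noteq> []"
  shows "closed_iso (Or (big_or As) (big_or Bs)) (big_or (As @ Bs))"
  using assms(1)
proof (induction As rule: list_nonempty_induct)
  case (single A)
  show ?case using assms(2) by (simp add: big_or_Cons closed_iso_refl)
next
  case (cons A As)
  have "closed_iso (Or (big_or (A # As)) (big_or Bs)) (Or A (Or (big_or As) (big_or Bs)))"
    using cons.hyps by (simp add: big_or_Cons Or_assoc)
  also have "closed_iso \<dots> (Or A (big_or (As @ Bs)))"
    by (intro closed_iso_Or cons.IH closed_iso_refl)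
  finally show ?case using cons.hyps by (simp add: big_or_Cons)
qed

lemma C_formsE:
  assumes "c \<in> C_forms"
  obtains cbs where "c = big_and (map (\<lambda>(c, b). Imp c b) cbs)"
    "\<forall>c b. (c, b) \<in> set cbs \<longrightarrow> c \<in> C_forms \<and> b \<in> B_forms"
  using assms by (cases rule: C_forms.cases) blast

text \<open>Two products multiply by concatenating their lists of factors.\<close>

lemma iso_to_C_And:
  assumes "iso_to_C F" "iso_to_C G"
  shows "iso_to_C (And F G)"
proof -
  from assms obtain c d where c: "c \<in> C_forms" "closed_iso F c" and d: "d \<in> C_forms" "closed_iso G d"
    unfolding iso_to_C_def by blast
  obtain cs where cs: "c = big_and (map (\<lambda>(c, b). Imp c b) cs)"
    "\<forall>c b. (c, b) \<in> set cs \<longrightarrow> c \<in> C_forms \<and> b \<in> B_forms"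
    using c(1) by (rule C_formsE)
  obtain ds where ds: "d = big_and (map (\<lambda>(c, b). Imp c b) ds)"
    "\<forall>c b. (c, b) \<in> set ds \<longrightarrow> c \<in> C_forms \<and> b \<in> B_forms"
    using d(1) by (rule C_formsE)
  have "closed_iso (And F G) (And c d)"
    by (rule closed_iso_And[OF c(2) d(2)])
  also have "closed_iso \<dots> (big_and (map (\<lambda>(c, b). Imp c b) (cs @ ds)))"
    unfolding cs(1) ds(1) map_append by (rule big_and_append)
  finally have "closed_iso (And F G) (big_and (map (\<lambda>(c, b). Imp c b) (cs @ ds)))" .
  moreover have "big_and (map (\<lambda>(c, b). Imp c b) (cs @ ds)) \<in> C_forms"
    using cs(2) ds(2) by (intro C_conj) auto
  ultimately show ?thesis unfolding iso_to_C_def by blast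
qed

section \<open>Addition and multiplication of sums\<close>

lemma iso_to_sum_Or:
  assumes "iso_to_sum F" "iso_to_sum G"
  shows "iso_to_sum (Or F G)"
proof -
  from assms obtain cs ds where cs: "cs \<noteq> []" "set cs \<subseteq> C_forms" "closed_iso F (big_or cs)"
    and ds: "ds \<noteq> []" "set ds \<subseteq> C_forms" "closed_iso G (big_or ds)"
    unfolding iso_to_sum_def by blast
  have "closed_iso (Or F G) (big_or (cs @ ds))"
    by (rule closed_iso_trans[OF closed_iso_Or[OF cs(3) ds(3)] big_or_append[OF cs(1) ds(1)]])
  moreover have "cs @ ds \<noteq> []" "set (cs @ ds) \<subseteq> C_forms"
    using cs ds by auto
  ultimately show ?thesis unfolding iso_to_sum_def by blast
qed

text \<open>Hides the list: a property transported along \<open>closed_iso\<close> has to be checked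
  only for a product and for a sum with a product in front.\<close>

lemma iso_to_sum_induct [consumes 1, case_names cong C Or]:
  assumes "iso_to_sum F"
    and cong: "\<And>F G. closed_iso F G \<Longrightarrow> P G \<Longrightarrow> P F"
    and C: "\<And>c. c \<in> C_forms \<Longrightarrow> P c"
    and Or: "\<And>c F. c \<in> C_forms \<Longrightarrow> P F \<Longrightarrow> P (Or c F)"
  shows "P F"
proof -
  from assms(1) obtain cs where cs: "cs \<noteq> []" "set cs \<subseteq> C_forms" "closed_iso F (big_or cs)"
    unfolding iso_to_sum_def by blast
  from cs(1,2) have "P (big_or cs)"
    by (induction cs rule: list_nonempty_induct) (simp_all add: big_or_Cons C Or)
  with cs(3) show ?thesis by (rule cong)
qed

text \<open>\<open>And_Or\<close> distributes over a sum in the left factor, hence the detour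
  through \<open>And F c\<close>.\<close>

lemma iso_to_sum_And_C:
  assumes "iso_to_sum F" "c \<in> C_forms"
  shows "iso_to_sum (And c F)"
proof -
  have "iso_to_sum (And F c)"
    using assms(1)
  proof (induction rule: iso_to_sum_induct)
    case (cong F F')
    then show ?case by (blast intro: iso_to_sum_cong closed_iso_And closed_iso_refl)
  next
    case (C d)
    then show ?case using assms(2)
      by (intro iso_to_C_imp_sum iso_to_C_And C_forms_iso_to_C)
  next
    case (Or d F)
    have "iso_to_sum (And d c)"
      using Or.hyps assms(2) by (intro iso_to_C_imp_sum iso_to_C_And C_forms_iso_to_C)
    then show ?case by (rule iso_to_sum_cong[OF And_Or iso_to_sum_Or[OF _ Or.IH]])
  qed
  then show ?thesis by (rule iso_to_sum_cong[OF And_comm])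
qed

text \<open>Distributivity in the form \<open>(c + F) G = c G + F G\<close>, by induction on the
  left factor.\<close>

lemma iso_to_sum_And:
  assumes "iso_to_sum F" "iso_to_sum G"
  shows "iso_to_sum (And F G)"
  using assms(1)
proof (induction rule: iso_to_sum_induct)
  case (cong F F')
  then show ?case by (blast intro: iso_to_sum_cong closed_iso_And closed_iso_refl)
next
  case (C c)
  then show ?case by (rule iso_to_sum_And_C[OF assms(2)])
next
  case (Or c F)
  show ?case
    by (rule iso_to_sum_cong[OF And_Or iso_to_sum_Or[OF iso_to_sum_And_C[OF assms(2) Or.hyps] Or.IH]])
qed

section \<open>Powers\<close>

lemma Imp_B_iso_to_C:
  assumes "iso_to_C F" "b \<in> B_forms"
  shows "iso_to_C (Imp F b)"
proof -
  from assms(1) obtain c where c: "c \<in> C_forms" "closed_iso F c"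
    unfolding iso_to_C_def by blast
  have "big_and (map (\<lambda>(c, b). Imp c b) [(c, b)]) \<in> C_forms"
    using c(1) assms(2) by (intro C_conj) simp
  then show ?thesis
    using closed_iso_Imp[OF c(2) closed_iso_refl] unfolding iso_to_C_def by auto
qed

lemma Top_in_C_forms: "Top \<in> C_forms"
  using C_conj[of "[]"] by simp

text \<open>The exponent is distributed over the factors of the base, and \<open>curry\<close>
  merges it with the exponent of each factor. The empty product is settled by
  \<open>Imp_Top\<close>.\<close>

lemma iso_to_C_Imp_C:
  assumes "iso_to_C F" "c \<in> C_forms"
  shows "iso_to_C (Imp F c)"
proof -
  obtain cbs where cbs: "c = big_and (map (\<lambda>(c, b). Imp c b) cbs)"
    "\<forall>c b. (c, b) \<in> set cbs \<longrightarrow> c \<in> C_forms \<and> b \<in> B_forms"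
    using assms(2) by (rule C_formsE)
  from cbs(2) have "iso_to_C (Imp F (big_and (map (\<lambda>(c, b). Imp c b) cbs)))"
  proof (induction cbs)
    case Nil
    show ?case
      using iso_to_C_cong[OF Imp_Top C_forms_iso_to_C[OF Top_in_C_forms]] by simp
  next
    case (Cons cb cbs)
    obtain c b where cb: "cb = (c, b)" by fastforce
    then have "c \<in> C_forms" "b \<in> B_forms" using Cons.prems by auto
    then have "iso_to_C (Imp F (Imp c b))"
      by (intro iso_to_C_cong[OF curry] Imp_B_iso_to_C iso_to_C_And assms(1) C_forms_iso_to_C)
    moreover have "iso_to_C (Imp F (big_and (map (\<lambda>(c, b). Imp c b) cbs)))"
      using Cons by simp
    ultimately have "iso_to_C (Imp F (And (Imp c b) (big_and (map (\<lambda>(c, b). Imp c b) cbs))))"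
      by (intro iso_to_C_cong[OF Imp_And] iso_to_C_And)
    then show ?case
      using iso_to_C_cong[OF closed_iso_Imp[OF closed_iso_refl big_and_Cons]] cb by simp
  qed
  with cbs(1) show ?thesis by simp
qed

text \<open>A base with at least two terms is itself in \<open>B_forms\<close> and is left intact; a
  base with one term is a product and gets expanded.\<close>

lemma iso_to_C_Imp_sum:
  assumes "iso_to_C F" "iso_to_sum G"
  shows "iso_to_C (Imp F G)"
proof -
  from assms(2) obtain cs where cs: "cs \<noteq> []" "set cs \<subseteq> C_forms" "closed_iso G (big_or cs)"
    unfolding iso_to_sum_def by blast
  have "iso_to_C (Imp F (big_or cs))"
  proof (cases "length cs \<ge> 2")
    case True
    then have "big_or cs \<in> B_forms" using cs(2) by (blast intro: B_disj D_disj)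
    with assms(1) show ?thesis by (rule Imp_B_iso_to_C)
  next
    case False
    then obtain c where "cs = [c]" using cs(1) by (cases cs rule: big_or.cases) auto
    then show ?thesis using iso_to_C_Imp_C[OF assms(1)] cs(2) by simp
  qed
  then show ?thesis
    by (rule iso_to_C_cong[OF closed_iso_Imp[OF closed_iso_refl cs(3)]])
qed

text \<open>Induction on the exponent with \<open>Imp_Or\<close>: a sum in the exponent becomes a
  product of powers, so the result is a product even if both arguments are sums.\<close>

lemma iso_to_C_Imp:
  assumes "iso_to_sum F" "iso_to_sum G"
  shows "iso_to_C (Imp F G)"
  using assms(1)
proof (induction rule: iso_to_sum_induct)
  case (cong F F')
  then show ?case by (blast intro: iso_to_C_cong closed_iso_Imp closed_iso_refl)
next
  case (C c)
  then show ?case by (intro iso_to_C_Imp_sum C_forms_iso_to_C assms(2))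
next
  case (Or c F)
  have "iso_to_C (Imp c G)"
    by (rule iso_to_C_Imp_sum[OF C_forms_iso_to_C[OF Or.hyps] assms(2)])
  then show ?case by (rule iso_to_C_cong[OF Imp_Or iso_to_C_And[OF _ Or.IH]])
qed

lemma iso_to_sum_fm: "iso_to_sum F"
proof (induction F)
  case (Prime p)
  \<comment> \<open>A prime is a base and not a product; the exponent \<open>Top\<close> makes it a
    product of one factor.\<close>
  have "iso_to_C (Imp Top (Prime p))"
    by (intro Imp_B_iso_to_C C_forms_iso_to_C Top_in_C_forms B_prime)
  then show ?case
    by (rule iso_to_C_imp_sum[OF iso_to_C_cong[OF closed_iso_sym[OF Top_Imp]]])
next
  case Top
  show ?case by (intro iso_to_C_imp_sum C_forms_iso_to_C Top_in_C_forms)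
next
  case (And F G)
  then show ?case by (rule iso_to_sum_And)
next
  case (Or F G)
  then show ?case by (rule iso_to_sum_Or)
next
  case (Imp F G)
  then show ?case by (rule iso_to_C_imp_sum[OF iso_to_C_Imp])
qed

theorem theorem1:
  fixes F :: "'p fm"
  assumes "top_free F"
  shows "\<exists>e \<in> D_forms \<union> C_forms. F \<cong> e"
proof -
  obtain cs where cs: "cs \<noteq> []" "set cs \<subseteq> C_forms" "closed_iso F (big_or cs)"
    using iso_to_sum_fm[of F] unfolding iso_to_sum_def by blast
  \<comment> \<open>\<open>D_disj\<close> asks for at least two terms; a sum of one term is that
    term itself and lies in \<open>C_forms\<close>.\<close>
  have "big_or cs \<in> D_forms \<union> C_forms"
  proof (cases "length cs \<ge> 2")
    case True
    then show ?thesis using cs(2) by (blast intro: D_disj)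
  next
    case False
    then obtain c where "cs = [c]" using cs(1) by (cases cs rule: big_or.cases) auto
    then show ?thesis using cs(2) by simp
  qed
  then show ?thesis using closed_iso_imp_iso[OF cs(3)] by blast
qed

end
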